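(* For every positive integer $k$ divisible by $9$ there exists a total $0$-$1$ matrix $M$ with $\operatorname{rank}_+(M)=k$ and $\operatorname{rank}_{0,1}(M)=\frac{4}{3}k$.
   Context: A total $0$-$1$ matrix is a finite matrix all of whose entries are in $\{0,1\}$. For a total $0$-$1$ matrix $M$ of size $n\times m$: the nonnegative rank $\operatorname{rank}_+(M)$ is the smallest $r$ such that $M=UV$ with $U$ an $n\times r$ and $V$ an $r\times m$ real matrix, both entrywise nonnegative; the binary rank $\operatorname{rank}_{0,1}(M)$ is the smallest $r$ such that $M=UV$ (ordinary arithmetic over the reals) with $U$ an $n\times r$ and $V$ an $r\times m$ matrix, both with all entries in $\{0,1\}$. *)

theory Defs
  imports "Jordan_Normal_Form.Matrix"
begin

definition zero_one_mat :: "real mat \<Rightarrow> bool" where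
  "zero_one_mat A \<longleftrightarrow> elements_mat A \<subseteq> {0, 1}"

definition nonneg_mat :: "real mat \<Rightarrow> bool" where
  "nonneg_mat A \<longleftrightarrow> elements_mat A \<subseteq> {0..}"

definition nonneg_factorization :: "real mat \<Rightarrow> nat \<Rightarrow> bool" where
  "nonneg_factorization M r \<longleftrightarrow>
     (\<exists>U \<in> carrier_mat (dim_row M) r. \<exists>V \<in> carrier_mat r (dim_col M).
        nonneg_mat U \<and> nonneg_mat V \<and> M = U * V)"

definition binary_factorization :: "real mat \<Rightarrow> nat \<Rightarrow> bool" where
  "binary_factorization M r \<longleftrightarrow>
     (\<exists>U \<in> carrier_mat (dim_row M) r. \<exists>V \<in> carrier_mat r (dim_col M).
        zero_one_mat U \<and> zero_one_mat V \<and> M = U * V)"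

(* Both minima exist when M is a 0-1 matrix, since M = M * 1\<^sub>m (dim_col M);
   for other arguments LEAST may be unspecified. *)

definition nonneg_rank :: "real mat \<Rightarrow> nat" where
  "nonneg_rank M = (LEAST r. nonneg_factorization M r)"

definition binary_rank :: "real mat \<Rightarrow> nat" where
  "binary_rank M = (LEAST r. binary_factorization M r)"

lemma zero_one_mat_one: "zero_one_mat (1\<^sub>m n)"
  by (auto simp: zero_one_mat_def elements_mat_def)

lemma zero_one_mat_nonneg: "zero_one_mat A \<Longrightarrow> nonneg_mat A"
  by (auto simp: zero_one_mat_def nonneg_mat_def)

lemma binary_factorization_trivial:
  assumes "zero_one_mat M"
  shows "binary_factorization M (dim_col M)"
  unfolding binary_factorization_def
proof (intro bexI conjI)
  show "M \<in> carrier_mat (dim_row M) (dim_col M)" by auto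
  show "1\<^sub>m (dim_col M) \<in> carrier_mat (dim_col M) (dim_col M)" by auto
  show "M = M * 1\<^sub>m (dim_col M)" by (rule right_mult_one_mat[symmetric]) auto
qed (use assms zero_one_mat_one in auto)

lemma binary_factorization_imp_nonneg:
  "binary_factorization M r \<Longrightarrow> nonneg_factorization M r"
  unfolding binary_factorization_def nonneg_factorization_def
  using zero_one_mat_nonneg by blast

end

(* Nine units split into three groups of three; a column is a pair of units inside one group or a
   transversal of the three groups. The twelve rows are the nine units and, for each group a, the
   row S_a that is half of the sum of the units outside a. Every column has 0 or 2 units outside a,
   so S_a is a 0-1 row and the matrix has nonnegative rank 9, with a fooling set of nine pairs.
   In a partition of the ones into rectangles, call a rectangle solo if exactly one of its rows is
   a unit. If some unit i0 has no solo rectangle, then each unit still has a private rectangle, and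
   three transversals through i0, otherwise disjoint, need three further ones. Otherwise there are
   nine solo rectangles, and they alone cannot cover the three pairs of group a both in the row S_b
   and in the rows of a; the further rectangles needed for (a, b) = (0, 1), (1, 2), (2, 0) are
   pairwise distinct. Hence the binary rank is 12. Both ranks are multiplied by j when passing to
   j diagonal copies. *)
theory Submission
  imports Defs
begin

section \<open>Partitions into rectangles, and fooling sets\<close>

text \<open>\<open>A t\<close> and \<open>B t\<close> are the row set and the column set of
  rectangle \<open>t\<close>. The index set \<open>R\<close> is explicit because a single block will
  be covered by a subset of it.\<close>

definition exact_cover ::
  "nat \<Rightarrow> nat \<Rightarrow> (nat \<Rightarrow> nat \<Rightarrow> bool) \<Rightarrow> 't set \<Rightarrow> ('t \<Rightarrow> nat \<Rightarrow> bool) \<Rightarrow> ('t \<Rightarrow> nat \<Rightarrow> bool) \<Rightarrow> bool"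
where
  "exact_cover n m P R A B \<longleftrightarrow>
     (\<forall>x<n. \<forall>y<m. card {t \<in> R. A t x \<and> B t y} = of_bool (P x y))"

lemma exact_cover_sound:
  assumes "exact_cover n m P R A B" "finite R" "t \<in> R" "A t x" "B t y" "x < n" "y < m"
  shows "P x y"
proof (rule ccontr)
  assume "\<not> P x y"
  with assms have "card {t \<in> R. A t x \<and> B t y} = 0"
    by (simp add: exact_cover_def)
  with assms show False by auto
qed

lemma exact_cover_ex:
  assumes "exact_cover n m P R A B" "P x y" "x < n" "y < m"
  shows "\<exists>t\<in>R. A t x \<and> B t y"
proof -
  have "card {t \<in> R. A t x \<and> B t y} = 1"
    using assms by (simp add: exact_cover_def)
  then show ?thesis by (metis (no_types, lifting) card_1_singletonE insertI1 mem_Collect_eq)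
qed

lemma exact_cover_unique:
  assumes "exact_cover n m P R A B" "finite R" "x < n" "y < m"
    and "t \<in> R" "A t x" "B t y" "t' \<in> R" "A t' x" "B t' y"
  shows "t = t'"
proof -
  have "card {t \<in> R. A t x \<and> B t y} \<le> 1"
    using assms by (simp add: exact_cover_def)
  then show ?thesis using assms card_le_Suc0_iff_eq[of "{t \<in> R. A t x \<and> B t y}"] by auto
qed

lemma mult_mat_index_sum:
  assumes "U \<in> carrier_mat n r" "V \<in> carrier_mat r m" "x < n" "y < m"
  shows "(U * V) $$ (x, y) = (\<Sum>t<r. U $$ (x, t) * V $$ (t, y))"
  using assms by (auto simp: scalar_prod_def lessThan_atLeast0 intro!: sum.cong)

text \<open>Column \<open>t\<close> of \<open>U\<close> and row \<open>t\<close> of \<open>V\<close>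
  are the indicators of a rectangle, so an entry of the product counts the rectangles through that
  cell.\<close>

lemma binary_factorization_exact_cover:
  assumes "binary_factorization (mat n m (\<lambda>(x, y). of_bool (P x y))) r"
  obtains A B where "exact_cover n m P {..<r} A B"
proof -
  from assms obtain U V where UV: "U \<in> carrier_mat n r" "V \<in> carrier_mat r m"
    "zero_one_mat U" "zero_one_mat V"
    and eq: "mat n m (\<lambda>(x, y). of_bool (P x y)) = U * V"
    by (auto simp: binary_factorization_def)
  define A where "A = (\<lambda>t x. U $$ (x, t) = 1)"
  define B where "B = (\<lambda>t y. V $$ (t, y) = 1)"
  have "exact_cover n m P {..<r} A B"
    unfolding exact_cover_def
  proof (intro allI impI)
    fix x y assume xy: "x < n" "y < m"
    have u: "U $$ (x, t) \<in> {0, 1}" if "t < r" for t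
      using UV(3) elements_matI[OF UV(1) xy(1) that] by (auto simp: zero_one_mat_def)
    have v: "V $$ (t, y) \<in> {0, 1}" if "t < r" for t
      using UV(4) elements_matI[OF UV(2) that xy(2)] by (auto simp: zero_one_mat_def)
    have "of_bool (P x y) = (U * V) $$ (x, y)"
      using xy by (simp flip: eq)
    also have "\<dots> = (\<Sum>t<r. U $$ (x, t) * V $$ (t, y))"
      by (rule mult_mat_index_sum[OF UV(1,2) xy])
    also have "\<dots> = (\<Sum>t<r. if A t x \<and> B t y then 1 else 0)"
      using u v by (intro sum.cong) (auto simp: A_def B_def)
    also have "\<dots> = real (card {t \<in> {..<r}. A t x \<and> B t y})"
      by (simp add: sum.If_cases Collect_conj_eq lessThan_def)
    finally show "card {t \<in> {..<r}. A t x \<and> B t y} = of_bool (P x y)"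
      by (metis of_nat_eq_iff of_nat_of_bool)
  qed
  then show thesis by (rule that)
qed

text \<open>For each \<open>i\<close> some inner index \<open>t\<close> has both factors nonzero.
  Nonnegative terms cannot cancel, so two members of \<open>I\<close> sharing \<open>t\<close> would
  make both crossed entries positive, which \<open>fool\<close> forbids.\<close>

lemma nonneg_factorization_fooling_set:
  assumes "nonneg_factorization M r" and "finite I"
    and "\<And>i. i \<in> I \<Longrightarrow> \<rho> i < dim_row M \<and> \<gamma> i < dim_col M \<and> M $$ (\<rho> i, \<gamma> i) \<noteq> 0"
    and fool: "\<And>i j. i \<in> I \<Longrightarrow> j \<in> I \<Longrightarrow> i \<noteq> j \<Longrightarrow> M $$ (\<rho> i, \<gamma> j) = 0 \<or> M $$ (\<rho> j, \<gamma> i) = 0"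
  shows "card I \<le> r"
proof -
  from assms(1) obtain U V where U: "U \<in> carrier_mat (dim_row M) r" "nonneg_mat U"
    and V: "V \<in> carrier_mat r (dim_col M)" "nonneg_mat V" and eq: "M = U * V"
    by (auto simp: nonneg_factorization_def)
  have sum: "M $$ (x, y) = (\<Sum>t<r. U $$ (x, t) * V $$ (t, y))"
    if "x < dim_row M" "y < dim_col M" for x y
    by (subst eq) (rule mult_mat_index_sum[OF U(1) V(1) that])
  have u: "U $$ (x, t) \<ge> 0" if "x < dim_row M" "t < r" for x t
    using U(2) elements_matI[OF U(1) that] by (auto simp: nonneg_mat_def)
  have v: "V $$ (t, y) \<ge> 0" if "y < dim_col M" "t < r" for y t
    using V(2) elements_matI[OF V(1) that(2,1)] by (auto simp: nonneg_mat_def)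
  have "\<exists>t<r. U $$ (\<rho> i, t) \<noteq> 0 \<and> V $$ (t, \<gamma> i) \<noteq> 0" if "i \<in> I" for i
  proof (rule ccontr)
    assume "\<not> ?thesis"
    then have "(\<Sum>t<r. U $$ (\<rho> i, t) * V $$ (t, \<gamma> i)) = 0" by (intro sum.neutral) auto
    with assms(3)[OF that] sum show False by auto
  qed
  then obtain \<tau> where \<tau>: "\<And>i. i \<in> I \<Longrightarrow> \<tau> i < r \<and> U $$ (\<rho> i, \<tau> i) \<noteq> 0 \<and> V $$ (\<tau> i, \<gamma> i) \<noteq> 0"
    by metis
  have pos: "M $$ (x, y) \<noteq> 0"
    if "x < dim_row M" "y < dim_col M" "t < r" "U $$ (x, t) \<noteq> 0" "V $$ (t, y) \<noteq> 0" for x y t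
  proof -
    have "0 < U $$ (x, t) * V $$ (t, y)"
      using u[OF that(1,3)] v[OF that(2,3)] that(4,5) by simp
    also have "\<dots> \<le> M $$ (x, y)"
      unfolding sum[OF that(1,2)] using that u v by (intro member_le_sum) auto
    finally show ?thesis by simp
  qed
  have "inj_on \<tau> I"
  proof (rule inj_onI, rule ccontr)
    fix i j assume "i \<in> I" "j \<in> I" "\<tau> i = \<tau> j" "i \<noteq> j"
    with fool[of i j] pos assms(3) \<tau> show False by metis
  qed
  then have "card I \<le> card {..<r}"
    using \<tau> by (intro card_inj_on_le[of \<tau>]) auto
  then show ?thesis by simp
qed

section \<open>Block diagonal copies\<close>

definition block_rep :: "nat \<Rightarrow> nat \<Rightarrow> (nat \<Rightarrow> nat \<Rightarrow> real) \<Rightarrow> nat \<Rightarrow> real mat" where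
  "block_rep n m f j =
     mat (n * j) (m * j) (\<lambda>(x, y). if x div n = y div m then f (x mod n) (y mod m) else 0)"

lemma block_rep_of_bool:
  "block_rep n m (\<lambda>x y. of_bool (P x y)) j =
     mat (n * j) (m * j) (\<lambda>(x, y). of_bool (x div n = y div m \<and> P (x mod n) (y mod m)))"
  unfolding block_rep_def by (intro cong_mat) auto

lemma elements_block_rep_subset:
  assumes "\<And>x y. x < n \<Longrightarrow> y < m \<Longrightarrow> f x y \<in> S" "0 \<in> S"
  shows "elements_mat (block_rep n m f j) \<subseteq> S"
proof
  fix a assume "a \<in> elements_mat (block_rep n m f j)"
  then obtain x y where "x < n * j" "y < m * j"
    "a = (if x div n = y div m then f (x mod n) (y mod m) else 0)"
    by (auto simp: elements_mat_def block_rep_def)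
  moreover from this have "x mod n < n" "y mod m < m"
    by (metis mod_less_divisor mult_0 not_gr_zero not_less_zero)+
  ultimately show "a \<in> S" using assms by auto
qed

text \<open>A row of block \<open>b\<close> meets only the inner indices \<open>p * b + i\<close>
  with \<open>i < p\<close>, so the sum collapses to that block.\<close>

lemma block_rep_mult:
  assumes "0 < p"
    and h: "\<And>x y. x < n \<Longrightarrow> y < m \<Longrightarrow> h x y = (\<Sum>i<p. f x i * g i y)"
  shows "block_rep n p f j * block_rep p m g j = block_rep n m h j" (is "?U * ?V = ?M")
proof (rule eq_matI)
  fix x y assume "x < dim_row ?M" "y < dim_col ?M"
  then have x: "x < n * j" and y: "y < m * j" by (auto simp: block_rep_def)
  have n: "0 < n" and m: "0 < m" using x y by (auto intro: Nat.gr0I)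
  define b where "b = x div n"
  have b: "b < j" using x n by (simp add: b_def less_mult_imp_div_less mult.commute)
  have UV: "?U \<in> carrier_mat (n * j) (p * j)" "?V \<in> carrier_mat (p * j) (m * j)"
    by (auto simp: block_rep_def)
  have "(?U * ?V) $$ (x, y) = (\<Sum>t<p * j. ?U $$ (x, t) * ?V $$ (t, y))"
    by (rule mult_mat_index_sum[OF UV x y])
  also have "\<dots> = (\<Sum>t \<in> (\<lambda>i. p * b + i) ` {..<p}. ?U $$ (x, t) * ?V $$ (t, y))"
  proof (rule sum.mono_neutral_right)
    have "p * b + i < p * j" if "i < p" for i
    proof -
      have "p * b + i < p * Suc b" using that by simp
      also have "\<dots> \<le> p * j" using b by (intro mult_le_mono2) simp
      finally show ?thesis .
    qed
    then show "(\<lambda>i. p * b + i) ` {..<p} \<subseteq> {..<p * j}" by auto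
    show "\<forall>t \<in> {..<p * j} - (\<lambda>i. p * b + i) ` {..<p}. ?U $$ (x, t) * ?V $$ (t, y) = 0"
    proof
      fix t assume t: "t \<in> {..<p * j} - (\<lambda>i. p * b + i) ` {..<p}"
      have "t div p \<noteq> b"
      proof
        assume "t div p = b"
        then have "t = p * b + t mod p" by auto
        with t assms(1) show False by (metis DiffE imageI lessThan_iff mod_less_divisor)
      qed
      then show "?U $$ (x, t) * ?V $$ (t, y) = 0"
        using t x by (auto simp: block_rep_def b_def)
    qed
  qed simp
  also have "\<dots> = (\<Sum>i<p. ?U $$ (x, p * b + i) * ?V $$ (p * b + i, y))"
    by (subst sum.reindex) (auto simp: inj_on_def)
  also have "\<dots> = (\<Sum>i<p. if b = y div m then f (x mod n) i * g i (y mod m) else 0)"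
  proof (rule sum.cong)
    fix i assume i: "i \<in> {..<p}"
    have "p * b + i < p * Suc b" using i by simp
    also have "\<dots> \<le> p * j" using b by (intro mult_le_mono2) simp
    finally have "p * b + i < p * j" .
    moreover have "(p * b + i) div p = b" "(p * b + i) mod p = i" using i by auto
    ultimately show "?U $$ (x, p * b + i) * ?V $$ (p * b + i, y) =
        (if b = y div m then f (x mod n) i * g i (y mod m) else 0)"
      using x y by (simp add: block_rep_def b_def)
  qed simp
  also have "\<dots> = ?M $$ (x, y)"
    using x y h[of "x mod n" "y mod m"] n m by (simp add: block_rep_def b_def)
  finally show "(?U * ?V) $$ (x, y) = ?M $$ (x, y)" .
qed (auto simp: block_rep_def)

text \<open>A rectangle with a row in one block and a column in another would cover a zero, so no
  rectangle serves two blocks.\<close>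

lemma exact_cover_block_lower_bound:
  assumes block: "\<And>(R :: 't set) A B. finite R \<Longrightarrow> exact_cover n m P R A B \<Longrightarrow> c \<le> card R"
    and fin: "finite (R :: 't set)"
    and cover: "exact_cover (n * j) (m * j)
      (\<lambda>x y. x div n = y div m \<and> P (x mod n) (y mod m)) R A B"
  shows "c * j \<le> card R"
proof -
  have index: "n * b + x < n * j \<and> (n * b + x) div n = b \<and> (n * b + x) mod n = x"
    if "b < j" "x < n" for b x n :: nat
  proof -
    have "n * b + x < n * Suc b" using that by simp
    also have "\<dots> \<le> n * j" using that by (intro mult_le_mono2) simp
    finally show ?thesis using that by auto
  qed
  define Rb where "Rb b = {t \<in> R. (\<exists>x<n. A t (n * b + x)) \<and> (\<exists>y<m. B t (m * b + y))}" for b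
  have lower: "c \<le> card (Rb b)" if "b < j" for b
  proof (rule block)
    show "finite (Rb b)" using fin by (simp add: Rb_def)
    show "exact_cover n m P (Rb b) (\<lambda>t x. A t (n * b + x)) (\<lambda>t y. B t (m * b + y))"
      unfolding exact_cover_def
    proof (intro allI impI)
      fix x y assume xy: "x < n" "y < m"
      have "{t \<in> Rb b. A t (n * b + x) \<and> B t (m * b + y)}
          = {t \<in> R. A t (n * b + x) \<and> B t (m * b + y)}"
        using xy by (auto simp: Rb_def)
      then show "card {t \<in> Rb b. A t (n * b + x) \<and> B t (m * b + y)} = of_bool (P x y)"
        using cover index[OF that xy(1)] index[OF that xy(2)]
        by (simp add: exact_cover_def)
    qed
  qed
  have "Rb b \<inter> Rb b' = {}" if bb': "b < j" "b' < j" "b \<noteq> b'" for b b'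
  proof (rule ccontr)
    assume "\<not> ?thesis"
    then obtain t x y where t: "t \<in> R" "x < n" "A t (n * b + x)" "y < m" "B t (m * b' + y)"
      by (auto simp: Rb_def)
    from exact_cover_sound[OF cover fin t(1,3,5)] bb' index[OF bb'(1) t(2)] index[OF bb'(2) t(4)]
    show False by auto
  qed
  then have "card (\<Union>b<j. Rb b) = (\<Sum>b<j. card (Rb b))"
    using fin by (intro card_UN_disjoint) (auto simp: Rb_def)
  also have "\<dots> \<ge> (\<Sum>b<j. c)" using lower by (intro sum_mono) auto
  finally have "c * j \<le> card (\<Union>b<j. Rb b)" by (simp add: mult.commute)
  also have "\<dots> \<le> card R" using fin by (intro card_mono) (auto simp: Rb_def)
  finally show ?thesis .
qed

section \<open>The gadget: units, pairs and transversals\<close>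

text \<open>Units and pairs are numbered 0 to 8, and the group of both is their quotient by 3; the pair
  \<open>y\<close> is \<open>{y, cyc y}\<close>, where \<open>cyc\<close> rotates each group. The columns 9 to 17 are the transversals
  \<open>{p, 3 + q, 6 + (p + q) mod 3}\<close>, a Latin square: two of them share at most one unit. The row
  \<open>9 + a\<close> of the gadget is \<open>S\<^sub>a\<close>.\<close>

definition cyc :: "nat \<Rightarrow> nat" where
  "cyc i = (if i mod 3 = 2 then i - 2 else i + 1)"

definition incident :: "nat \<Rightarrow> nat \<Rightarrow> bool" where
  "incident i y \<longleftrightarrow>
     (if y < 9 then i = y \<or> i = cyc y
      else i = (y - 9) div 3 \<or> i = 3 + (y - 9) mod 3 \<or> i = 6 + ((y - 9) div 3 + (y - 9) mod 3) mod 3)"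

definition gadget :: "nat \<Rightarrow> nat \<Rightarrow> bool" where
  "gadget x y \<longleftrightarrow> (if x < 9 then incident x y else y < 9 \<longrightarrow> y div 3 \<noteq> x - 9)"

text \<open>The left factor, of inner dimension 9; the right factor is the incidence matrix of units
  and columns.\<close>

definition gadget_left :: "nat \<Rightarrow> nat \<Rightarrow> real" where
  "gadget_left x i =
     (if x < 9 then of_bool (x = i) else if i div 3 = x - 9 then 0 else 1 / 2)"

lemma less_3_cases: "(i::nat) < 3 \<Longrightarrow> i \<in> {0,1,2}" by auto

lemma less_9_cases: "(i::nat) < 9 \<Longrightarrow> i \<in> {0,1,2,3,4,5,6,7,8}" by auto

lemma less_18_cases: "(i::nat) < 18 \<Longrightarrow> i \<in> {0,1,2,3,4,5,6,7,8,9,10,11,12,13,14,15,16,17}"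
  by simp presburger

lemma gadget_half_sum:
  assumes "a < 3" "y < 18"
  shows "(\<Sum>i<9. if i div 3 = a then 0 else if incident i y then 1 / 2 else 0)
    = (of_bool (gadget (9 + a) y) :: real)"
proof -
  have "\<forall>y \<in> {0,1,2,3,4,5,6,7,8,9,10,11,12,13,14,15,16,17}. \<forall>a \<in> {0,1,2}.
      (\<Sum>i\<in>{0,1,2,3,4,5,6,7,8}. if i div 3 = a then 0 else if incident i y then 1 / 2 else 0)
      = (of_bool (gadget (9 + a) y) :: real)"
    by (simp add: incident_def cyc_def gadget_def)
  note bspec[OF bspec[OF this less_18_cases[OF assms(2)]] less_3_cases[OF assms(1)]]
  moreover have "{..<9::nat} = {0,1,2,3,4,5,6,7,8}" by auto
  ultimately show ?thesis by (simp only:)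
qed

lemma gadget_factorization:
  assumes "x < 12" "y < 18"
  shows "of_bool (gadget x y) = (\<Sum>i<9. gadget_left x i * of_bool (incident i y))"
proof (cases "x < 9")
  case True
  then have "(\<Sum>i<9. gadget_left x i * of_bool (incident i y))
      = (\<Sum>i<9. if x = i then of_bool (incident x y) else 0)"
    by (intro sum.cong) (auto simp: gadget_left_def)
  with True show ?thesis by (simp add: gadget_def)
next
  case False
  then have "(\<Sum>i<9. gadget_left x i * of_bool (incident i y))
      = (\<Sum>i<9. if i div 3 = x - 9 then 0 else if incident i y then 1 / 2 else 0)"
    by (intro sum.cong) (auto simp: gadget_left_def)
  also have "\<dots> = of_bool (gadget (9 + (x - 9)) y)"
    using assms by (intro gadget_half_sum) auto
  finally show ?thesis using False by simp
qed

lemma cyc_props: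
  assumes "i < 9"
  shows "cyc i < 9" "cyc i div 3 = i div 3" "cyc i \<noteq> i" "cyc (cyc i) \<noteq> i" "cyc (cyc (cyc i)) = i"
proof -
  have "\<forall>i \<in> {0,1,2,3,4,5,6,7,8}. cyc i < 9 \<and> cyc i div 3 = i div 3 \<and> cyc i \<noteq> i
      \<and> cyc (cyc i) \<noteq> i \<and> cyc (cyc (cyc i)) = i"
    by (simp add: cyc_def)
  from bspec[OF this less_9_cases[OF assms]]
  show "cyc i < 9" "cyc i div 3 = i div 3" "cyc i \<noteq> i" "cyc (cyc i) \<noteq> i" "cyc (cyc (cyc i)) = i"
    by simp_all
qed

lemma incident_pair: "y < 9 \<Longrightarrow> incident i y \<longleftrightarrow> i = y \<or> i = cyc y"
  by (simp add: incident_def)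

text \<open>A rotation of order three swaps no two units. This makes the cells of unit
  \<open>i\<close> and pair \<open>i\<close> a fooling set.\<close>

lemma incident_pair_antisym:
  assumes "i < 9" "j < 9" "incident i j" "incident j i"
  shows "i = j"
  using assms cyc_props(4)[of j] by (auto simp: incident_pair)

text \<open>If \<open>i = cyc j\<close>, then \<open>cyc i\<close> would be the third unit of the
  group, which pair \<open>j\<close> misses. This tells apart the rectangles chosen for units
  without a solo one.\<close>

lemma pair_unique:
  assumes "i < 9" "j < 9" "incident i j" "incident (cyc i) j"
  shows "i = j"
  using assms cyc_props(4,5)[of j] by (auto simp: incident_pair)

lemma no_pair_in_transversal:
  assumes "i < 9" "9 \<le> y" "y < 18" "incident i y"
  shows "\<not> incident (cyc i) y"
proof -
  have "\<forall>y \<in> {9,10,11,12,13,14,15,16,17}. \<forall>i \<in> {0,1,2,3,4,5,6,7,8}.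
      incident i y \<longrightarrow> \<not> incident (cyc i) y"
    by (simp add: incident_def cyc_def)
  moreover have "y \<in> {9,10,11,12,13,14,15,16,17}" using assms less_18_cases[of y] by auto
  ultimately show ?thesis using less_9_cases[OF assms(1)] assms(4) by blast
qed

text \<open>The two common units lie in distinct groups and so fix two of the three Latin square
  coordinates, which determine the remaining one.\<close>

lemma transversal_unique:
  assumes ij: "i \<noteq> j" and "9 \<le> y" "y < 18" "9 \<le> y'" "y' < 18"
    and "incident i y" "incident j y" "incident i y'" "incident j y'"
  shows "y = y'"
proof -
  define p q p' q' where "p = (y - 9) div 3" and "q = (y - 9) mod 3"
    and "p' = (y' - 9) div 3" and "q' = (y' - 9) mod 3"
  define r r' where "r = (p + q) mod 3" and "r' = (p' + q') mod 3"
  have y: "y = 9 + 3 * p + q" "y' = 9 + 3 * p' + q'"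
    unfolding p_def q_def p'_def q'_def using assms
    by (metis add.assoc le_add_diff_inverse mult_div_mod_eq)+
  have small: "p < 3" "q < 3" "r < 3" "p' < 3" "q' < 3" "r' < 3"
    unfolding p_def q_def p'_def q'_def r_def r'_def using assms by auto
  have coord: "l = p \<and> p = p' \<or> l = 3 + q \<and> q = q' \<or> l = 6 + r \<and> r = r'"
    if "incident l y" "incident l y'" for l
  proof -
    have "l = p \<or> l = 3 + q \<or> l = 6 + r" "l = p' \<or> l = 3 + q' \<or> l = 6 + r'"
      using that assms by (auto simp: incident_def p_def q_def r_def p'_def q'_def r'_def)
    then show ?thesis using small by (elim disjE) simp_all
  qed
  have "p = p' \<and> q = q' \<or> p = p' \<and> r = r' \<or> q = q' \<and> r = r'"
    using coord[of i] coord[of j] assms(6-) ij by metis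
  moreover have "q = q'" if "p = p'" "r = r'"
    using that less_3_cases[OF small(1)] less_3_cases[OF small(2)] less_3_cases[OF small(5)]
    by (auto simp: r_def r'_def)
  moreover have "p = p'" if "q = q'" "r = r'"
    using that less_3_cases[OF small(2)] less_3_cases[OF small(1)] less_3_cases[OF small(4)]
    by (auto simp: r_def r'_def)
  ultimately have "p = p' \<and> q = q'" by blast
  then show ?thesis using y by simp
qed

lemma transversals_card:
  assumes "i < 9"
  shows "card {y \<in> {9..<18}. incident i y} = 3"
proof -
  have "{9..<18::nat} = {9,10,11,12,13,14,15,16,17}" by auto
  then show ?thesis
    using less_9_cases[OF assms]
    by (auto simp: incident_def conj_disj_distribR Collect_disj_eq Collect_conv_if)
qed

section \<open>Twelve rectangles are needed for the gadget\<close>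

lemma gadget_lower_bound:
  fixes R :: "'t set"
  assumes fin: "finite R" and cover: "exact_cover 12 18 gadget R A B"
  shows "12 \<le> card R"
proof -
  note sound = exact_cover_sound[OF cover fin]
  have unit_sound: "incident i y" if "t \<in> R" "A t i" "B t y" "i < 9" "y < 18" for t i y
    using sound[OF that(1-3)] that(4,5) by (simp add: gadget_def)
  have "\<forall>x y. \<exists>t. x < 12 \<and> y < 18 \<and> gadget x y \<longrightarrow> t \<in> R \<and> A t x \<and> B t y"
    using exact_cover_ex[OF cover] by blast
  then obtain cov where cov: "\<And>x y. x < 12 \<Longrightarrow> y < 18 \<Longrightarrow> gadget x y \<Longrightarrow>
      cov x y \<in> R \<and> A (cov x y) x \<and> B (cov x y) y"
    by metis
  have unit_cov: "cov i y \<in> R \<and> A (cov i y) i \<and> B (cov i y) y"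
    if "i < 9" "y < 18" "incident i y" for i y
    using cov[of i y] that by (simp add: gadget_def)
  \<comment> \<open>Only unit rows count: a solo rectangle may contain any of the rows
    \<open>9 + a\<close>.\<close>
  define solo where "solo t i \<longleftrightarrow> t \<in> R \<and> (\<forall>j<9. A t j \<longleftrightarrow> j = i)" for t i
  have solo_row: "A t j \<longleftrightarrow> j = i" if "solo t i" "j < 9" for t i j
    using that by (simp add: solo_def)
  show ?thesis
  proof (cases "\<forall>i<9. \<exists>t. solo t i")
    case False
    then obtain i0 where i0: "i0 < 9" "\<And>t. \<not> solo t i0" by blast
    \<comment> \<open>The private rectangle of unit \<open>i\<close>: a solo one if there is any,
      else the one covering the cell of unit \<open>i\<close> and pair \<open>i\<close>.\<close>
    define r where "r i = (if \<exists>t. solo t i then SOME t. solo t i else cov i i)" for i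
    have r_solo: "solo (r i) i" if "solo t i" for t i
    proof -
      have "r i = (SOME t. solo t i)" using that by (auto simp: r_def)
      then show ?thesis using someI[of "\<lambda>t. solo t i", OF that] by simp
    qed
    have other: "\<exists>j<9. j \<noteq> i \<and> A t j" if "\<And>t. \<not> solo t i" "t \<in> R" "A t i" for t i
      using that unfolding solo_def by blast
    \<comment> \<open>Not being solo, the rectangle has a second unit, and pair \<open>i\<close>
      leaves only \<open>cyc i\<close>.\<close>
    have r_pair: "A (r i) i \<and> A (r i) (cyc i) \<and> B (r i) i" if i: "i < 9" "\<And>t. \<not> solo t i" for i
    proof -
      have r: "r i = cov i i" using i by (simp add: r_def)
      have c: "cov i i \<in> R" "A (cov i i) i" "B (cov i i) i"
        using unit_cov[of i i] i(1) by (auto simp: incident_pair)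
      obtain j where j: "j < 9" "j \<noteq> i" "A (cov i i) j" using other[OF i(2) c(1,2)] by blast
      then have "j = cyc i" using unit_sound[OF c(1) j(3) c(3)] i(1) by (auto simp: incident_pair)
      with j c r show ?thesis by simp
    qed
    have r_R: "r i \<in> R" if "i < 9" for i
    proof (cases "\<exists>t. solo t i")
      case True
      then show ?thesis using r_solo by (auto simp: solo_def)
    next
      case False
      then show ?thesis using unit_cov[of i i] that by (simp add: r_def incident_pair)
    qed
    \<comment> \<open>A solo rectangle is recognized by its only unit; a non-solo \<open>r i\<close>
      contains \<open>i\<close> and \<open>cyc i\<close>, so \<open>i\<close> is the only pair it
      can cover.\<close>
    have "inj_on r {..<9}"
    proof (rule inj_onI)
      fix i j assume ij: "i \<in> {..<9}" "j \<in> {..<9}" "r i = r j"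
      show "i = j"
      proof (cases "\<exists>t. solo t i")
        case True
        then have s: "solo (r i) i" using r_solo by blast
        have "A (r j) j"
          using r_solo[of _ j] r_pair[of j] solo_row[of "r j" j j] ij by blast
        then show ?thesis using solo_row[OF s, of j] ij by simp
      next
        case i: False
        then have *: "A (r i) i" "A (r i) (cyc i)" using r_pair[of i] ij by blast+
        show ?thesis
        proof (cases "\<exists>t. solo t j")
          case True
          then have "solo (r j) j" using r_solo by blast
          from solo_row[OF this, of i] show ?thesis using *(1) ij by simp
        next
          case False
          then have "B (r i) j" using r_pair[of j] ij by (metis lessThan_iff)
          then have "incident i j" "incident (cyc i) j"
            using unit_sound[of "r i" i j] unit_sound[of "r i" "cyc i" j] * r_R ij cyc_props(1)[of i]
            by auto
          then show ?thesis using pair_unique ij by auto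
        qed
      qed
    qed
    then have card_r: "card (r ` {..<9}) = 9" by (simp add: card_image)
    define Tr where "Tr = {y \<in> {9..<18}. incident i0 y}"
    have g: "cov i0 y \<in> R" "A (cov i0 y) i0" "B (cov i0 y) y" if "y \<in> Tr" for y
      using unit_cov[of i0 y] i0(1) that by (auto simp: Tr_def)
    \<comment> \<open>A rectangle through \<open>i0\<close> has another unit \<open>j\<close>, and
      at most one transversal contains both.\<close>
    have "inj_on (cov i0) Tr"
    proof (rule inj_onI)
      fix y y' assume y: "y \<in> Tr" "y' \<in> Tr" "cov i0 y = cov i0 y'"
      obtain j where j: "j < 9" "j \<noteq> i0" "A (cov i0 y) j" using other[OF i0(2) g(1,2)] y(1) by blast
      have "incident j y" "incident j y'"
        using unit_sound[OF g(1) j(3) g(3) j(1)] unit_sound[of "cov i0 y'" j y'] g[OF y(2)] j y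
        by (auto simp: Tr_def)
      then show "y = y'" using transversal_unique[of i0 j y y'] j y by (auto simp: Tr_def)
    qed
    then have card_g: "card (cov i0 ` Tr) = 3"
      using transversals_card[OF i0(1)] by (simp add: card_image Tr_def)
    \<comment> \<open>A solo \<open>r i\<close> through \<open>i0\<close> would be solo for
      \<open>i0\<close>; a non-solo one holds two units of one group, which no transversal
      contains.\<close>
    have "r i \<noteq> cov i0 y" if i: "i < 9" and y: "y \<in> Tr" for i y
    proof
      assume eq: "r i = cov i0 y"
      show False
      proof (cases "\<exists>t. solo t i")
        case True
        then have "solo (r i) i" using r_solo by blast
        from solo_row[OF this, of i0] have "i = i0" using g(2)[OF y] eq i0(1) by simp
        with True i0(2) show False by blast
      next
        case False
        then have "A (r i) i" "A (r i) (cyc i)" using r_pair[of i] i by blast+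
        then have "incident i y" "incident (cyc i) y"
          using unit_sound[of "cov i0 y" i y] unit_sound[of "cov i0 y" "cyc i" y] g[OF y] eq i y
            cyc_props(1)[OF i] by (auto simp: Tr_def)
        then show False using no_pair_in_transversal[OF i, of y] y by (auto simp: Tr_def)
      qed
    qed
    then have "card (r ` {..<9} \<union> cov i0 ` Tr) = 12"
      using card_r card_g by (subst card_Un_disjoint) (auto simp: Tr_def)
    moreover have "r ` {..<9} \<union> cov i0 ` Tr \<subseteq> R" using r_R g(1) by auto
    ultimately show ?thesis using card_mono[OF fin] by metis
  next
    case True
    then obtain s where s: "\<And>i. i < 9 \<Longrightarrow> solo (s i) i" by metis
    have s_R: "s i \<in> R" if "i < 9" for i using s[OF that] by (simp add: solo_def)
    have s_row: "A (s i) j \<longleftrightarrow> j = i" if "i < 9" "j < 9" for i j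
      using solo_row[OF s[OF that(1)] that(2)] .
    have inj_s: "inj_on s {..<9}" using s_row by (metis inj_onI lessThan_iff)
    \<comment> \<open>Otherwise the solo rectangles alone would cover, on the three pairs of group
      \<open>a\<close>, both the units of that group and the row
      \<open>9 + (a + 1) mod 3\<close>.\<close>
    have "\<exists>t \<in> R - s ` {..<9}. \<exists>y<9. y div 3 = a \<and> B t y \<and>
        (A t (9 + (a + 1) mod 3) \<or> (\<exists>i<9. i div 3 = a \<and> A t i))" if a: "a < 3" for a
    proof (rule ccontr)
      assume "\<not> ?thesis"
      then have in_s: "t \<in> s ` {..<9}"
        if "t \<in> R" "y < 9" "y div 3 = a" "B t y"
          "A t (9 + (a + 1) mod 3) \<or> (\<exists>i<9. i div 3 = a \<and> A t i)" for t y
        using that by blast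
      define b where "b = 9 + (a + 1) mod 3"
      have b: "b < 12" "9 \<le> b" "b - 9 \<noteq> a" using less_3_cases[OF a] by (auto simp: b_def)
      have own: "B (s i) y" if y: "y < 9" "y div 3 = a" "incident i y" for i y
      proof -
        have i: "i < 9" "i div 3 = a" using y cyc_props(1,2)[of y] by (auto simp: incident_pair)
        have t: "cov i y \<in> R" "A (cov i y) i" "B (cov i y) y" using unit_cov[of i y] i y by auto
        then obtain j where "j < 9" "cov i y = s j" using in_s[of "cov i y" y] y i by blast
        then show ?thesis using t s_row[of j i] i by auto
      qed
      \<comment> \<open>The solo rectangle covering row \<open>b\<close> in column \<open>y\<close>
        brings its own unit along, which must lie on pair \<open>y\<close>.\<close>
      have half: "\<exists>i. incident i y \<and> A (s i) b" if y: "y < 9" "y div 3 = a" for y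
      proof -
        have "gadget b y" using b y by (auto simp: gadget_def)
        then have t: "cov b y \<in> R" "A (cov b y) b" "B (cov b y) y" using cov[of b y] b y by auto
        then obtain i where i: "i < 9" "cov b y = s i" using in_s[of "cov b y" y] y
          unfolding b_def by blast
        then have "incident i y" using unit_sound[OF s_R[OF i(1)], of i y] s_row[of i i] t y by auto
        then show ?thesis using t i by auto
      qed
      obtain i where i: "incident i (3 * a)" "A (s i) b" using half[of "3 * a"] a by auto
      then have i9: "i < 9" "i div 3 = a"
        using a cyc_props(1,2)[of "3 * a"] by (auto simp: incident_pair)
      note c = cyc_props[OF i9(1)]
      \<comment> \<open>Pair \<open>cyc i\<close> is the one pair of the group that avoids
        \<open>i\<close>, so it yields a second unit.\<close>
      obtain j where j: "incident j (cyc i)" "A (s j) b"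
        using half[of "cyc i"] c i9 by auto
      have "j = cyc i \<or> j = cyc (cyc i)" using j(1) c(1) by (simp add: incident_pair)
      then have j9: "j < 9" "j div 3 = a" "j \<noteq> i"
        using c(1-4) cyc_props(1,2)[OF c(1)] i9(2) by (elim disjE; simp)+
      \<comment> \<open>Two units of one group always form a pair \<open>z\<close>; its cell in row
        \<open>b\<close> then lies in both \<open>s i\<close> and \<open>s j\<close>.\<close>
      obtain z where z: "z < 9" "z div 3 = a" "incident i z" "incident j z"
      proof (cases "j = cyc i")
        case True
        then show thesis using that[of i] i9 by (simp add: incident_pair)
      next
        case False
        then have "j = cyc (cyc i)" using j(1) c(1) by (simp add: incident_pair)
        then show thesis using that[of j] i9 j9 c(5) by (simp add: incident_pair)
      qed
      have "s i = s j"
        using exact_cover_unique[OF cover fin b(1), of z "s i" "s j"] own[OF z(1,2)] z(1,3,4)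
          s_R i9 j9 i(2) j(2) by auto
      with inj_s i9 j9 show False by (auto dest: inj_onD)
    qed
    then obtain \<tau> where \<tau>: "\<And>a. a < 3 \<Longrightarrow> \<tau> a \<in> R - s ` {..<9} \<and> (\<exists>y<9. y div 3 = a \<and> B (\<tau> a) y \<and>
        (A (\<tau> a) (9 + (a + 1) mod 3) \<or> (\<exists>i<9. i div 3 = a \<and> A (\<tau> a) i)))"
      by metis
    have \<tau>_R: "\<tau> ` {..<3} \<subseteq> R - s ` {..<9}"
      using \<tau> by (intro image_subsetI) (simp only: lessThan_iff)
    \<comment> \<open>A shared rectangle meets a pair of group \<open>a'\<close>, which excludes the
      units of group \<open>a\<close>. It must then contain the row
      \<open>9 + (a + 1) mod 3\<close>, which is zero on the pairs of group
      \<open>(a + 1) mod 3\<close>.\<close>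
    have row: "a' \<noteq> (a + 1) mod 3" if a: "a < 3" "a' < 3" "a \<noteq> a'" "\<tau> a = \<tau> a'" for a a'
    proof -
      obtain y where y: "y < 9" "y div 3 = a'" "B (\<tau> a) y" using \<tau>[OF a(2)] a(4) by auto
      have R: "\<tau> a \<in> R" using \<tau>[OF a(1)] by blast
      have "i div 3 \<noteq> a" if "i < 9" "A (\<tau> a) i" for i
        using unit_sound[OF R that(2) y(3) that(1)] y cyc_props(2)[of y] a(3)
        by (auto simp: incident_pair)
      then have "A (\<tau> a) (9 + (a + 1) mod 3)" using \<tau>[OF a(1)] by blast
      from sound[OF R this y(3)] y show ?thesis by (auto simp: gadget_def)
    qed
    \<comment> \<open>Of two distinct residues modulo 3 one is the successor of the other, so
      \<open>row\<close> fails in one of the two orders.\<close>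
    have "inj_on \<tau> {..<3}"
    proof (rule inj_onI, rule ccontr)
      fix a a' assume a: "a \<in> {..<3}" "a' \<in> {..<3}" "\<tau> a = \<tau> a'" "a \<noteq> a'"
      then show False
        using row[of a a'] row[of a' a] less_3_cases[of a] less_3_cases[of a'] by auto
    qed
    moreover have "s ` {..<9} \<inter> \<tau> ` {..<3} = {}" using \<tau>_R by blast
    ultimately have "card (s ` {..<9} \<union> \<tau> ` {..<3}) = 12"
      using inj_s by (simp add: card_Un_disjoint card_image)
    moreover have "s ` {..<9} \<union> \<tau> ` {..<3} \<subseteq> R" using s_R \<tau>_R by blast
    ultimately show ?thesis using card_mono[OF fin] by metis
  qed
qed

section \<open>Both ranks of the diagonal copies\<close>

theorem mainTheorem3:
  fixes k :: nat
  assumes "k > 0" and "9 dvd k"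
  shows "\<exists>M :: real mat. zero_one_mat M \<and> nonneg_rank M = k \<and>
           real (binary_rank M) = 4 / 3 * real k"
proof -
  obtain j where k: "k = 9 * j" using assms(2) by blast
  define M where "M = block_rep 12 18 (\<lambda>x y. of_bool (gadget x y)) j"
  have dim: "dim_row M = 12 * j" "dim_col M = 18 * j" by (simp_all add: M_def block_rep_def)
  have M01: "zero_one_mat M"
    unfolding zero_one_mat_def M_def by (rule elements_block_rep_subset) auto
  have "nonneg_factorization M (9 * j)"
    unfolding nonneg_factorization_def
  proof (intro bexI conjI)
    show "M = block_rep 12 9 gadget_left j * block_rep 9 18 (\<lambda>i y. of_bool (incident i y)) j"
      unfolding M_def by (rule block_rep_mult[symmetric]) (simp_all add: gadget_factorization)
    show "nonneg_mat (block_rep 12 9 gadget_left j)"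
      unfolding nonneg_mat_def
      by (rule elements_block_rep_subset) (auto simp: gadget_left_def)
    show "nonneg_mat (block_rep 9 18 (\<lambda>i y. of_bool (incident i y)) j)"
      unfolding nonneg_mat_def by (rule elements_block_rep_subset) auto
  qed (auto simp: dim block_rep_def)
  moreover have "9 * j \<le> r" if "nonneg_factorization M r" for r
  proof -
    have "card {..<9 * j} \<le> r"
    \<comment> \<open>Index \<open>i\<close> stands for unit and pair \<open>i mod 9\<close> in
      block \<open>i div 9\<close>; a block has 12 rows and 18 columns.\<close>
    proof (rule nonneg_factorization_fooling_set[OF that,
          where \<rho> = "\<lambda>i. 12 * (i div 9) + i mod 9" and \<gamma> = "\<lambda>i. 18 * (i div 9) + i mod 9"])
      have entry: "12 * (i div 9) + i mod 9 < 12 * j \<and> 18 * (i' div 9) + i' mod 9 < 18 * j \<and>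
          M $$ (12 * (i div 9) + i mod 9, 18 * (i' div 9) + i' mod 9) =
          of_bool (i div 9 = i' div 9 \<and> incident (i mod 9) (i' mod 9))"
        if i: "i \<in> {..<9 * j}" "i' \<in> {..<9 * j}" for i i'
      proof -
        have "i div 9 < j" "i' div 9 < j" "i mod 9 < 9" "i' mod 9 < 9" using i by auto
        then have "12 * (i div 9) + i mod 9 < 12 * j" "18 * (i' div 9) + i' mod 9 < 18 * j"
          "(12 * (i div 9) + i mod 9) div 12 = i div 9" "(12 * (i div 9) + i mod 9) mod 12 = i mod 9"
          "(18 * (i' div 9) + i' mod 9) div 18 = i' div 9" "(18 * (i' div 9) + i' mod 9) mod 18 = i' mod 9"
          by auto
        then show ?thesis by (simp add: M_def block_rep_def gadget_def)
      qed
      show "12 * (i div 9) + i mod 9 < dim_row M \<and> 18 * (i div 9) + i mod 9 < dim_col M \<and>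
          M $$ (12 * (i div 9) + i mod 9, 18 * (i div 9) + i mod 9) \<noteq> 0"
        if "i \<in> {..<9 * j}" for i
        using entry[OF that that] by (simp add: dim incident_pair)
      show "M $$ (12 * (i div 9) + i mod 9, 18 * (i' div 9) + i' mod 9) = 0 \<or>
          M $$ (12 * (i' div 9) + i' mod 9, 18 * (i div 9) + i mod 9) = 0"
        if i: "i \<in> {..<9 * j}" "i' \<in> {..<9 * j}" "i \<noteq> i'" for i i'
      proof -
        have "i div 9 \<noteq> i' div 9 \<or> i mod 9 \<noteq> i' mod 9"
          using i(3) by (metis div_mult_mod_eq)
        then show ?thesis
          using entry[OF i(1,2)] entry[OF i(2,1)] incident_pair_antisym[of "i mod 9" "i' mod 9"]
          by auto
      qed
    qed simp
    then show ?thesis by simp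
  qed
  ultimately have nonneg: "nonneg_rank M = 9 * j"
    unfolding nonneg_rank_def by (rule Least_equality)
  have "binary_factorization M (12 * j)"
    unfolding binary_factorization_def
  proof (intro bexI conjI)
    \<comment> \<open>A block has fewer rows than columns, so the identity goes on the left.\<close>
    show "M = 1\<^sub>m (12 * j) * M" using dim by (intro left_mult_one_mat[symmetric]) auto
  qed (use M01 zero_one_mat_one dim in auto)
  moreover have "12 * j \<le> r" if r: "binary_factorization M r" for r
  proof -
    have M: "M = mat (12 * j) (18 * j)
        (\<lambda>(x, y). of_bool (x div 12 = y div 18 \<and> gadget (x mod 12) (y mod 18)))"
      unfolding M_def by (rule block_rep_of_bool)
    obtain A B where "exact_cover (12 * j) (18 * j)
        (\<lambda>x y. x div 12 = y div 18 \<and> gadget (x mod 12) (y mod 18)) {..<r} A B"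
      using binary_factorization_exact_cover[OF r[unfolded M]] by blast
    then have "12 * j \<le> card {..<r}"
      by (rule exact_cover_block_lower_bound[rotated 2]) (auto intro: gadget_lower_bound)
    then show ?thesis by simp
  qed
  ultimately have "binary_rank M = 12 * j"
    unfolding binary_rank_def by (rule Least_equality)
  then show ?thesis using M01 nonneg k by (intro exI[of _ M]) auto
qed

end
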